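(* Let $x=(B_1,B_2,i,j)\in\mathbf M_{V,W}$ and $x'=(B_1',B_2',i',j')\in\mathbf M_{V',W'}$ be such that $B_1$ and $B_1'$ have no common eigenvalue. If $x$ and $x'$ are both stable (resp. both costable), then $\mathsf T(x,x')$ is stable (resp. costable).
   Context: For vector spaces $V,W$, $\mathbf M_{V,W}=\mathrm{End}(V)^{\oplus2}\oplus\mathrm{Hom}(W,V)\oplus\mathrm{Hom}(V,W)$. A datum $(B_1,B_2,i,j)$ is stable if no proper subspace of $V$ containing $\mathrm{Im}(i)$ is invariant under $B_1,B_2$, and costable if no nonzero subspace of $\mathrm{Ker}(j)$ is invariant under $B_1,B_2$. Let $\widetilde V=V\otimes W'\oplus W\otimes V'$, $\widetilde W=W\otimes W'$. When $B_1,B_1'$ have no common eigenvalue, $\mathsf T(x,x')\in\mathbf M_{\widetilde V,\widetilde W}$ is $$\Bigl(\begin{pmatrix}B_1\otimes\mathrm{Id}_{W'}&0\\0&\mathrm{Id}_W\otimes B_1'\end{pmatrix},\begin{pmatrix}B_2\otimes\mathrm{Id}_{W'}&\widetilde B^{(1,2)}\\\widetilde B^{(2,1)}&\mathrm{Id}_W\otimes B_2'\end{pmatrix},\begin{pmatrix}i\otimes\mathrm{Id}_{W'}\\\mathrm{Id}_W\otimes i'\end{pmatrix},\begin{pmatrix}j\otimes\mathrm{Id}_{W'}&\mathrm{Id}_W\otimes j'\end{pmatrix}\Bigr),$$ where $\widetilde B^{(1,2)}\colon W\otimes V'\to V\otimes W'$ and $\widetilde B^{(2,1)}\colon V\otimes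 W'\to W\otimes V'$ are the unique solutions of $(B_1\otimes\mathrm{Id}_{W'})\widetilde B^{(1,2)}-\widetilde B^{(1,2)}(\mathrm{Id}_W\otimes B_1')+i\otimes j'=0$ and $(\mathrm{Id}_W\otimes B_1')\widetilde B^{(2,1)}-\widetilde B^{(2,1)}(B_1\otimes\mathrm{Id}_{W'})+j\otimes i'=0$. *)

theory Defs
  imports "Jordan_Normal_Form.Matrix" "Jordan_Normal_Form.Char_Poly"
begin

text \<open>Finite-dimensional complex vector spaces are represented in coordinates:
  V = complex^n etc.; linear maps are matrices (JNF), acting on column vectors.
  A datum x = (B1,B2,i,j) in M_{V,W} with dim V = n, dim W = w means
  B1, B2 are n x n, i is n x w (map W to V), j is w x n (map V to W).\<close>

definition csubspace :: "nat \<Rightarrow> complex vec set \<Rightarrow> bool" where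
  "csubspace n S \<longleftrightarrow> S \<subseteq> carrier_vec n \<and> 0\<^sub>v n \<in> S \<and>
     (\<forall>u\<in>S. \<forall>v\<in>S. u + v \<in> S) \<and> (\<forall>c. \<forall>u\<in>S. c \<cdot>\<^sub>v u \<in> S)"

definition invariant2 :: "complex mat \<Rightarrow> complex mat \<Rightarrow> complex vec set \<Rightarrow> bool" where
  "invariant2 B1 B2 S \<longleftrightarrow> (\<forall>v\<in>S. B1 *\<^sub>v v \<in> S \<and> B2 *\<^sub>v v \<in> S)"

text \<open>Stable: no proper subspace of V containing Im(i) is invariant under B1, B2.\<close>
definition stable :: "complex mat \<times> complex mat \<times> complex mat \<times> complex mat \<Rightarrow> bool" where
  "stable x = (case x of (B1, B2, i, j) \<Rightarrow>
     (\<forall>S. csubspace (dim_row B1) S \<and> (\<forall>u\<in>carrier_vec (dim_col i). i *\<^sub>v u \<in> S)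
          \<and> invariant2 B1 B2 S \<longrightarrow> S = carrier_vec (dim_row B1)))"

text \<open>Costable: no nonzero subspace of Ker(j) is invariant under B1, B2.\<close>
definition costable :: "complex mat \<times> complex mat \<times> complex mat \<times> complex mat \<Rightarrow> bool" where
  "costable x = (case x of (B1, B2, i, j) \<Rightarrow>
     (\<forall>S. csubspace (dim_row B1) S \<and> S \<subseteq> {v. j *\<^sub>v v = 0\<^sub>v (dim_row j)}
          \<and> invariant2 B1 B2 S \<longrightarrow> S = {0\<^sub>v (dim_row B1)}))"

text \<open>Kronecker (tensor) product of matrices; basis e_a \<otimes> f_b of a tensor product
  of spaces of dimensions n and m is ordered as index a * m + b.\<close>
definition kron :: "complex mat \<Rightarrow> complex mat \<Rightarrow> complex mat" where
  "kron A B = mat (dim_row A * dim_row B) (dim_col A * dim_col B)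
     (\<lambda>(p, q). A $$ (p div dim_row B, q div dim_col B) * B $$ (p mod dim_row B, q mod dim_col B))"

text \<open>Block column (A over C) and block row (A beside B).\<close>
definition vstack :: "complex mat \<Rightarrow> complex mat \<Rightarrow> complex mat" where
  "vstack A C = mat (dim_row A + dim_row C) (dim_col A)
     (\<lambda>(p, q). if p < dim_row A then A $$ (p, q) else C $$ (p - dim_row A, q))"

definition hstack :: "complex mat \<Rightarrow> complex mat \<Rightarrow> complex mat" where
  "hstack A B = mat (dim_row A) (dim_col A + dim_col B)
     (\<lambda>(p, q). if q < dim_col A then A $$ (p, q) else B $$ (p, q - dim_col A))"

text \<open>Data: x = (B1,B2,i,j) with dim V = n, dim W = w; x' with dim V' = n', dim W' = w'.
  V~ = V\<otimes>W' \<oplus> W\<otimes>V' (dimension n*w' + w*n'), W~ = W\<otimes>W' (dimension w*w').\<close>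

definition Bt12 :: "complex mat \<times> complex mat \<times> complex mat \<times> complex mat \<Rightarrow>
    complex mat \<times> complex mat \<times> complex mat \<times> complex mat \<Rightarrow> complex mat" where
  "Bt12 x x' = (case x of (B1, B2, i, j) \<Rightarrow> case x' of (B1', B2', i', j') \<Rightarrow>
     let n = dim_row B1; w = dim_col i; n' = dim_row B1'; w' = dim_col i' in
     (THE X. X \<in> carrier_mat (n * w') (w * n') \<and>
        kron B1 (1\<^sub>m w') * X - X * kron (1\<^sub>m w) B1' + kron i j' = 0\<^sub>m (n * w') (w * n')))"

definition Bt21 :: "complex mat \<times> complex mat \<times> complex mat \<times> complex mat \<Rightarrow>
    complex mat \<times> complex mat \<times> complex mat \<times> complex mat \<Rightarrow> complex mat" where
  "Bt21 x x' = (case x of (B1, B2, i, j) \<Rightarrow> case x' of (B1', B2', i', j') \<Rightarrow>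
     let n = dim_row B1; w = dim_col i; n' = dim_row B1'; w' = dim_col i' in
     (THE X. X \<in> carrier_mat (w * n') (n * w') \<and>
        kron (1\<^sub>m w) B1' * X - X * kron B1 (1\<^sub>m w') + kron j i' = 0\<^sub>m (w * n') (n * w')))"

definition Tmap :: "complex mat \<times> complex mat \<times> complex mat \<times> complex mat \<Rightarrow>
    complex mat \<times> complex mat \<times> complex mat \<times> complex mat \<Rightarrow>
    complex mat \<times> complex mat \<times> complex mat \<times> complex mat" where
  "Tmap x x' = (case x of (B1, B2, i, j) \<Rightarrow> case x' of (B1', B2', i', j') \<Rightarrow>
     let n = dim_row B1; w = dim_col i; n' = dim_row B1'; w' = dim_col i' in
     (four_block_mat (kron B1 (1\<^sub>m w')) (0\<^sub>m (n * w') (w * n'))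
                     (0\<^sub>m (w * n') (n * w')) (kron (1\<^sub>m w) B1'),
      four_block_mat (kron B2 (1\<^sub>m w')) (Bt12 x x') (Bt21 x x') (kron (1\<^sub>m w) B2'),
      vstack (kron i (1\<^sub>m w')) (kron (1\<^sub>m w) i'),
      hstack (kron j (1\<^sub>m w')) (kron (1\<^sub>m w) j')))"

end

theory Submission
  imports Defs "HOL-Computational_Algebra.Fundamental_Theorem_Algebra"
    "HOL-Computational_Algebra.Field_as_Ring"
begin

text \<open>The matrix B1~ is block diagonal with blocks B1 \<otimes> 1 and 1 \<otimes> B1', which have the
  eigenvalues of B1 and of B1' respectively, hence none in common. So every B1~-invariant
  subspace S splits as the sum of its intersections with V \<otimes> W' and W \<otimes> V': for s in S, the
  Bezout combination u p + v q = 1 of coprime annihilating polynomials p, q of the two components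
  of s yields polynomials in B1~ mapping s to each component. Slicing along the standard bases of W' and W
  turns each part into a subspace of V resp. V' to which stability (costability) of x resp. x'
  applies.\<close>

section \<open>Block vectors and block matrices\<close>

lemma mat_vec_index_sum:
  "A \<in> carrier_mat r c \<Longrightarrow> v \<in> carrier_vec c \<Longrightarrow> p < r \<Longrightarrow>
   (A *\<^sub>v v) $ p = (\<Sum>q<c. A $$ (p, q) * v $ q)"
  by (auto simp: scalar_prod_def atLeast0LessThan mult.commute intro!: sum.cong)

lemma mult_mat_zero_vec [simp]: "dim_col A = c \<Longrightarrow> A *\<^sub>v 0\<^sub>v c = 0\<^sub>v (dim_row A)"
  by (rule eq_vecI) (auto simp: scalar_prod_def)

lemma smult_zero_vec [simp]: "c \<cdot>\<^sub>v 0\<^sub>v n = (0\<^sub>v n :: 'a :: semiring_0 vec)"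
  by (rule eq_vecI) auto

lemma vec_first_append [simp]: "a \<in> carrier_vec n \<Longrightarrow> vec_first (a @\<^sub>v b) n = a"
  by (rule eq_vecI) (auto simp: vec_first_def)

lemma vec_last_append [simp]: "b \<in> carrier_vec n \<Longrightarrow> vec_last (a @\<^sub>v b) n = b"
  by (rule eq_vecI) (auto simp: vec_last_def)

lemma four_block_mat_restrict:
  assumes "A \<in> carrier_mat r1 c1" and "D \<in> carrier_mat r2 c2"
  shows "four_block_mat A B C D = four_block_mat A (mat r1 c2 (($$) B)) (mat r2 c1 (($$) C)) D"
  using assms by (intro eq_matI) (auto simp: four_block_mat_def)

lemma vec_first_four_block_mat_mult:
  assumes A: "A \<in> carrier_mat r1 c1" and D: "D \<in> carrier_mat r2 c2" and a: "a \<in> carrier_vec c1"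
  shows "vec_first (four_block_mat A B C D *\<^sub>v (a @\<^sub>v 0\<^sub>v c2)) r1 = A *\<^sub>v a"
  using A D a by (subst four_block_mat_restrict[OF A D], subst four_block_mat_mult_vec) auto

lemma vec_last_four_block_mat_mult:
  assumes A: "A \<in> carrier_mat r1 c1" and D: "D \<in> carrier_mat r2 c2" and d: "d \<in> carrier_vec c2"
  shows "vec_last (four_block_mat A B C D *\<^sub>v (0\<^sub>v c1 @\<^sub>v d)) r2 = D *\<^sub>v d"
  using A D d by (subst four_block_mat_restrict[OF A D], subst four_block_mat_mult_vec) auto

lemma vstack_mult_vec:
  assumes "A \<in> carrier_mat r1 c" "C \<in> carrier_mat r2 c" "u \<in> carrier_vec c"
  shows "vstack A C *\<^sub>v u = (A *\<^sub>v u) @\<^sub>v (C *\<^sub>v u)"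
  using assms by (intro eq_vecI) (auto simp: vstack_def scalar_prod_def)

lemma hstack_mult_vec:
  assumes A: "A \<in> carrier_mat r c1" and B: "B \<in> carrier_mat r c2"
    and "a \<in> carrier_vec c1" "b \<in> carrier_vec c2"
  shows "hstack A B *\<^sub>v (a @\<^sub>v b) = A *\<^sub>v a + B *\<^sub>v b"
proof -
  have "hstack A B = four_block_mat A B (0\<^sub>m 0 c1) (0\<^sub>m 0 c2)"
    using A B by (intro eq_matI) (auto simp: hstack_def four_block_mat_def)
  also have "\<dots> *\<^sub>v (a @\<^sub>v b) = (A *\<^sub>v a + B *\<^sub>v b) @\<^sub>v (0\<^sub>m 0 c1 *\<^sub>v a + 0\<^sub>m 0 c2 *\<^sub>v b)"
    using assms by (intro four_block_mat_mult_vec) auto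
  also have "\<dots> = A *\<^sub>v a + B *\<^sub>v b"
    using A by (intro eq_vecI) auto
  finally show ?thesis .
qed

section \<open>Polynomials in a matrix applied to a vector\<close>

definition poly_mat_vec :: "'a::field mat \<Rightarrow> 'a poly \<Rightarrow> 'a vec \<Rightarrow> 'a vec" where
  "poly_mat_vec A p v =
     vec (dim_row A) (\<lambda>r. \<Sum>k\<le>degree p. coeff p k * (((*\<^sub>v) A ^^ k) v) $ r)"

lemma mat_pow_vec_carrier [simp]:
  "A \<in> carrier_mat n n \<Longrightarrow> v \<in> carrier_vec n \<Longrightarrow> ((*\<^sub>v) A ^^ k) v \<in> carrier_vec n"
  by (induct k) auto

lemma poly_mat_vec_carrier [simp]: "A \<in> carrier_mat n n \<Longrightarrow> poly_mat_vec A p v \<in> carrier_vec n"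
  unfolding poly_mat_vec_def by auto

lemma poly_mat_vec_0 [simp]: "poly_mat_vec A 0 v = 0\<^sub>v (dim_row A)"
  unfolding poly_mat_vec_def by (rule eq_vecI) auto

lemma poly_mat_vec_degree_bound:
  assumes "degree p < m"
  shows "poly_mat_vec A p v = vec (dim_row A) (\<lambda>r. \<Sum>k<m. coeff p k * (((*\<^sub>v) A ^^ k) v) $ r)"
proof -
  have "(\<Sum>k\<le>degree p. coeff p k * (((*\<^sub>v) A ^^ k) v) $ r)
      = (\<Sum>k<m. coeff p k * (((*\<^sub>v) A ^^ k) v) $ r)" for r
    using assms by (intro sum.mono_neutral_left) (auto simp: coeff_eq_0)
  then show ?thesis unfolding poly_mat_vec_def by simp
qed

lemma poly_mat_vec_pCons:
  assumes A: "A \<in> carrier_mat n n" and v: "v \<in> carrier_vec n"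
  shows "poly_mat_vec A (pCons a p) v = a \<cdot>\<^sub>v v + A *\<^sub>v poly_mat_vec A p v"
proof (rule eq_vecI)
  let ?m = "Suc (degree p)"
  let ?x = "\<lambda>k. ((*\<^sub>v) A ^^ k) v"
  fix r assume "r < dim_vec (a \<cdot>\<^sub>v v + A *\<^sub>v poly_mat_vec A p v)"
  then have r: "r < n" using A by simp
  have "degree (pCons a p) < Suc ?m"
    by (simp add: degree_pCons_le le_less_trans)
  then have "poly_mat_vec A (pCons a p) v $ r = (\<Sum>k<Suc ?m. coeff (pCons a p) k * ?x k $ r)"
    using A r by (simp add: poly_mat_vec_degree_bound)
  also have "\<dots> = a * v $ r + (\<Sum>k<?m. coeff p k * (A *\<^sub>v ?x k) $ r)"
    by (subst sum.lessThan_Suc_shift) simp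
  also have "(\<Sum>k<?m. coeff p k * (A *\<^sub>v ?x k) $ r)
      = (\<Sum>k<?m. \<Sum>c<n. A $$ (r, c) * (coeff p k * ?x k $ c))"
    using A v by (intro sum.cong refl, subst mat_vec_index_sum[OF A _ r])
      (auto simp: sum_distrib_left mult_ac)
  also have "\<dots> = (\<Sum>c<n. A $$ (r, c) * (\<Sum>k<?m. coeff p k * ?x k $ c))"
    by (simp add: sum_distrib_left sum.swap[of _ "{..<n}"] del: sum.lessThan_Suc)
  also have "\<dots> = (A *\<^sub>v poly_mat_vec A p v) $ r"
    using A r by (subst mat_vec_index_sum[OF A _ r])
      (auto simp: poly_mat_vec_degree_bound[of p ?m] simp del: sum.lessThan_Suc)
  finally show "poly_mat_vec A (pCons a p) v $ r = (a \<cdot>\<^sub>v v + A *\<^sub>v poly_mat_vec A p v) $ r"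
    using A r v by simp
qed (use A v in \<open>simp add: poly_mat_vec_def\<close>)

lemma poly_mat_vec_add:
  assumes A: "A \<in> carrier_mat n n" and v: "v \<in> carrier_vec n"
  shows "poly_mat_vec A (p + q) v = poly_mat_vec A p v + poly_mat_vec A q v"
proof (induct p q rule: poly_induct2)
  case 0
  show ?case using A by auto
next
  case (pCons a p b q)
  have "poly_mat_vec A (pCons a p + pCons b q) v
      = (a \<cdot>\<^sub>v v + b \<cdot>\<^sub>v v) + (A *\<^sub>v poly_mat_vec A p v + A *\<^sub>v poly_mat_vec A q v)"
    using A v by (simp add: poly_mat_vec_pCons pCons add_smult_distrib_vec mult_add_distrib_mat_vec)
  then show ?case
    using A v by (simp add: poly_mat_vec_pCons) auto
qed

lemma poly_mat_vec_smult:
  assumes A: "A \<in> carrier_mat n n" and v: "v \<in> carrier_vec n"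
  shows "poly_mat_vec A (Polynomial.smult c p) v = c \<cdot>\<^sub>v poly_mat_vec A p v"
proof (induct p)
  case (pCons a p)
  then show ?case
    using A v mult_mat_vec[OF A poly_mat_vec_carrier[OF A], of c p v]
    by (simp add: poly_mat_vec_pCons) (auto simp: algebra_simps)
qed (use A in auto)

lemma poly_mat_vec_mult:
  assumes A: "A \<in> carrier_mat n n" and v: "v \<in> carrier_vec n"
  shows "poly_mat_vec A (p * q) v = poly_mat_vec A p (poly_mat_vec A q v)"
proof (induct p)
  case 0
  show ?case by simp
next
  case (pCons a p)
  have "poly_mat_vec A (pCons a p * q) v = poly_mat_vec A (Polynomial.smult a q + pCons 0 (p * q)) v"
    by simp
  also have "\<dots> = a \<cdot>\<^sub>v poly_mat_vec A q v + A *\<^sub>v poly_mat_vec A p (poly_mat_vec A q v)"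
    using A v pCons by (simp add: poly_mat_vec_add poly_mat_vec_smult poly_mat_vec_pCons)
      auto
  also have "\<dots> = poly_mat_vec A (pCons a p) (poly_mat_vec A q v)"
    using A by (simp add: poly_mat_vec_pCons)
  finally show ?case .
qed

lemma poly_mat_vec_1:
  "A \<in> carrier_mat n n \<Longrightarrow> v \<in> carrier_vec n \<Longrightarrow> poly_mat_vec A 1 v = v"
  by (simp add: one_pCons poly_mat_vec_pCons)

lemma poly_mat_vec_zero_vec:
  assumes A: "A \<in> carrier_mat n n"
  shows "poly_mat_vec A p (0\<^sub>v n) = 0\<^sub>v n"
proof (induct p)
  case (pCons a p)
  then show ?case using A by (simp add: poly_mat_vec_pCons)
qed (use A in simp)

lemma poly_mat_vec_block_diag:
  assumes A: "A \<in> carrier_mat n1 n1" and D: "D \<in> carrier_mat n2 n2"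
    and a: "a \<in> carrier_vec n1" and d: "d \<in> carrier_vec n2"
  shows "poly_mat_vec (four_block_mat A (0\<^sub>m n1 n2) (0\<^sub>m n2 n1) D) p (a @\<^sub>v d)
       = poly_mat_vec A p a @\<^sub>v poly_mat_vec D p d"
proof (induct p)
  case 0
  show ?case using A D by auto
next
  case (pCons c p)
  have M: "four_block_mat A (0\<^sub>m n1 n2) (0\<^sub>m n2 n1) D \<in> carrier_mat (n1 + n2) (n1 + n2)"
    using A D by auto
  have ad: "a @\<^sub>v d \<in> carrier_vec (n1 + n2)" using a d by simp
  show ?case
    unfolding poly_mat_vec_pCons[OF M ad] poly_mat_vec_pCons[OF A a] poly_mat_vec_pCons[OF D d] pCons
    using A D a d by (subst mult_mat_vec_split[OF A D]) auto
qed

lemma poly_mat_vec_annihilator_exists: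
  assumes A: "A \<in> carrier_mat n n" and v: "v \<in> carrier_vec n"
  shows "\<exists>q. q \<noteq> 0 \<and> poly_mat_vec A q v = 0\<^sub>v n"
proof -
  \<comment> \<open>The \<open>n + 1\<close> vectors \<open>A\<^sup>k v\<close> are linearly dependent: bordered by a zero row they form
    a singular square matrix.\<close>
  define K where "K = mat\<^sub>r (Suc n) (Suc n)
    (\<lambda>r. if r = n then 0\<^sub>v (Suc n) else vec (Suc n) (\<lambda>k. (((*\<^sub>v) A ^^ k) v) $ r))"
  have K: "K \<in> carrier_mat (Suc n) (Suc n)" unfolding K_def by simp
  have "det K = 0"
    unfolding K_def by (rule det_row_0) auto
  then obtain x where x: "x \<in> carrier_vec (Suc n)" "x \<noteq> 0\<^sub>v (Suc n)" "K *\<^sub>v x = 0\<^sub>v (Suc n)"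
    using det_0_iff_vec_prod_zero[OF K] by auto
  define q where "q = Poly (list_of_vec x)"
  have coeff_q: "coeff q k = (if k < Suc n then x $ k else 0)" for k
    unfolding q_def using x(1) by (auto simp: nth_default_def)
  have "q \<noteq> 0"
  proof
    assume "q = 0"
    then have "x $ k = 0" if "k < Suc n" for k using coeff_q[of k] that by simp
    then have "x = 0\<^sub>v (Suc n)" using x(1) by auto
    with x(2) show False by simp
  qed
  moreover have "poly_mat_vec A q v = 0\<^sub>v n"
  proof (rule eq_vecI)
    fix r assume "r < dim_vec (0\<^sub>v n :: 'a vec)"
    then have r: "r < n" by simp
    have "degree q < Suc (Suc n)"
      unfolding q_def using degree_Poly[of "list_of_vec x"] x(1) by simp
    then have "poly_mat_vec A q v $ r = (\<Sum>k<Suc (Suc n). coeff q k * (((*\<^sub>v) A ^^ k) v) $ r)"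
      using A r by (simp add: poly_mat_vec_degree_bound)
    also have "\<dots> = (K *\<^sub>v x) $ r"
      using r x(1) K coeff_q
      by (auto simp: K_def scalar_prod_def atLeast0LessThan mult.commute intro!: sum.cong)
    finally show "poly_mat_vec A q v $ r = 0\<^sub>v n $ r" using x(3) r by simp
  qed (use A in simp)
  ultimately show ?thesis by blast
qed

lemma minimal_annihilator_roots_are_eigenvalues:
  assumes A: "A \<in> carrier_mat n n" and v: "v \<in> carrier_vec n"
  shows "\<exists>q. q \<noteq> 0 \<and> poly_mat_vec A q v = 0\<^sub>v n \<and> (\<forall>\<mu>. poly q \<mu> = 0 \<longrightarrow> eigenvalue A \<mu>)"
proof -
  let ?ann = "\<lambda>q. q \<noteq> 0 \<and> poly_mat_vec A q v = 0\<^sub>v n"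
  obtain q0 where "?ann q0" using poly_mat_vec_annihilator_exists[OF A v] by blast
  then obtain q where q: "q \<noteq> 0" "poly_mat_vec A q v = 0\<^sub>v n"
    and least: "\<And>r. ?ann r \<Longrightarrow> degree q \<le> degree r"
    using ex_has_least_nat[of ?ann q0 degree] by blast
  have "eigenvalue A \<mu>" if "poly q \<mu> = 0" for \<mu>
  proof -
    obtain r where qr: "q = [:-\<mu>, 1:] * r"
      using \<open>poly q \<mu> = 0\<close> by (auto simp: poly_eq_0_iff_dvd)
    with q(1) have r0: "r \<noteq> 0" by auto
    then have "degree q = Suc (degree r)"
      unfolding qr by (subst degree_mult_eq) auto
    \<comment> \<open>By minimality of \<open>q\<close>, \<open>w = r(A) v\<close> is nonzero, and \<open>(A - \<mu>) w = q(A) v = 0\<close>.\<close>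
    define w where "w = poly_mat_vec A r v"
    have w0: "w \<noteq> 0\<^sub>v n"
      using least[of r] r0 \<open>degree q = Suc (degree r)\<close> unfolding w_def by auto
    have w: "w \<in> carrier_vec n" unfolding w_def using A by simp
    have "0\<^sub>v n = poly_mat_vec A [:-\<mu>, 1:] w"
      using q(2) unfolding qr poly_mat_vec_mult[OF A v] w_def ..
    also have "\<dots> = (-\<mu>) \<cdot>\<^sub>v w + A *\<^sub>v w"
      using A w by (simp add: poly_mat_vec_pCons)
    finally have eq0: "0\<^sub>v n = (-\<mu>) \<cdot>\<^sub>v w + A *\<^sub>v w" .
    have "A *\<^sub>v w = \<mu> \<cdot>\<^sub>v w"
    proof (intro eq_vecI)
      fix i assume "i < dim_vec (\<mu> \<cdot>\<^sub>v w)"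
      with w have "i < n" by simp
      moreover have "((-\<mu>) \<cdot>\<^sub>v w + A *\<^sub>v w) $ i = 0\<^sub>v n $ i"
        using eq0 by simp
      ultimately show "(A *\<^sub>v w) $ i = (\<mu> \<cdot>\<^sub>v w) $ i" using A w by simp
    qed (use A w in simp)
    then show ?thesis
      unfolding eigenvalue_def eigenvector_def using A w w0 by auto
  qed
  with q show ?thesis by blast
qed

lemma coprime_if_no_common_root:
  fixes p q :: "complex poly"
  assumes "p \<noteq> 0" and "\<And>z. poly p z = 0 \<Longrightarrow> poly q z \<noteq> 0"
  shows "coprime p q"
proof (rule coprimeI)
  fix d assume dp: "d dvd p" and dq: "d dvd q"
  show "is_unit d"
  proof (rule ccontr)
    assume "\<not> is_unit d"
    moreover have "d \<noteq> 0" using dp assms(1) by auto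
    ultimately have "\<not> constant (poly d)"
      by (simp add: is_unit_iff_degree constant_degree)
    then obtain z where "poly d z = 0" using fundamental_theorem_of_algebra by blast
    with dp dq have "poly p z = 0" "poly q z = 0" by (auto simp: dvd_def)
    with assms(2) show False by blast
  qed
qed

section \<open>Subspaces\<close>

definition clinear_on :: "nat \<Rightarrow> nat \<Rightarrow> (complex vec \<Rightarrow> complex vec) \<Rightarrow> bool" where
  "clinear_on n m f \<longleftrightarrow> (\<forall>u\<in>carrier_vec n. f u \<in> carrier_vec m) \<and>
     (\<forall>u\<in>carrier_vec n. \<forall>v\<in>carrier_vec n. f (u + v) = f u + f v) \<and>
     (\<forall>c. \<forall>u\<in>carrier_vec n. f (c \<cdot>\<^sub>v u) = c \<cdot>\<^sub>v f u)"

lemma clinear_on_zero: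
  assumes "clinear_on n m f"
  shows "f (0\<^sub>v n) = 0\<^sub>v m"
proof -
  have f0: "f (0\<^sub>v n) \<in> carrier_vec m" and "f (0 \<cdot>\<^sub>v 0\<^sub>v n) = 0 \<cdot>\<^sub>v f (0\<^sub>v n)"
    using assms[unfolded clinear_on_def] zero_carrier_vec by blast+
  then have "f (0\<^sub>v n) = 0 \<cdot>\<^sub>v f (0\<^sub>v n)" by simp
  also have "\<dots> = 0\<^sub>v m" using f0 by (intro eq_vecI) auto
  finally show ?thesis .
qed

lemma csubspace_vimage:
  assumes "clinear_on n m f" and "csubspace m S"
  shows "csubspace n {u \<in> carrier_vec n. f u \<in> S}"
  using assms clinear_on_zero[OF assms(1)] unfolding csubspace_def clinear_on_def by auto

lemma csubspace_image:
  assumes f: "clinear_on n m f" and S: "csubspace n S"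
  shows "csubspace m (f ` S)"
proof -
  have "S \<subseteq> carrier_vec n" using S by (simp add: csubspace_def)
  then have fc: "\<And>u. u \<in> S \<Longrightarrow> f u \<in> carrier_vec m"
    and fadd: "\<And>u v. u \<in> S \<Longrightarrow> v \<in> S \<Longrightarrow> f (u + v) = f u + f v"
    and fsm: "\<And>c u. u \<in> S \<Longrightarrow> f (c \<cdot>\<^sub>v u) = c \<cdot>\<^sub>v f u"
    using f unfolding clinear_on_def by blast+
  have "0\<^sub>v m = f (0\<^sub>v n)" using clinear_on_zero[OF f] ..
  then show ?thesis
    using S fc unfolding csubspace_def by (auto simp: fadd[symmetric] fsm[symmetric])
qed

lemma poly_mat_vec_mem_invariant:
  assumes A: "A \<in> carrier_mat n n" and S: "csubspace n S"
    and inv: "\<forall>u\<in>S. A *\<^sub>v u \<in> S" and v: "v \<in> S"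
  shows "poly_mat_vec A p v \<in> S"
proof (induct p)
  case 0
  show ?case using A S by (simp add: csubspace_def)
next
  case (pCons a p)
  have "v \<in> carrier_vec n" using S v by (auto simp: csubspace_def)
  then show ?case
    using A S inv v pCons by (simp add: poly_mat_vec_pCons csubspace_def)
qed

section \<open>Subspaces of a direct sum\<close>

definition upper_part :: "nat \<Rightarrow> nat \<Rightarrow> complex vec set \<Rightarrow> complex vec set" where
  "upper_part n1 n2 S = {a \<in> carrier_vec n1. a @\<^sub>v 0\<^sub>v n2 \<in> S}"

definition lower_part :: "nat \<Rightarrow> nat \<Rightarrow> complex vec set \<Rightarrow> complex vec set" where
  "lower_part n1 n2 S = {d \<in> carrier_vec n2. 0\<^sub>v n1 @\<^sub>v d \<in> S}"

definition splits :: "nat \<Rightarrow> nat \<Rightarrow> complex vec set \<Rightarrow> bool" where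
  "splits n1 n2 S \<longleftrightarrow> (\<forall>s\<in>S. vec_first s n1 @\<^sub>v 0\<^sub>v n2 \<in> S \<and> 0\<^sub>v n1 @\<^sub>v vec_last s n2 \<in> S)"

lemma csubspace_upper_part: "csubspace (n1 + n2) S \<Longrightarrow> csubspace n1 (upper_part n1 n2 S)"
  unfolding upper_part_def
  by (rule csubspace_vimage) (auto simp: clinear_on_def)

lemma csubspace_lower_part: "csubspace (n1 + n2) S \<Longrightarrow> csubspace n2 (lower_part n1 n2 S)"
  unfolding lower_part_def
  by (rule csubspace_vimage) (auto simp: clinear_on_def)

lemma splits_mem_iff:
  assumes S: "csubspace (n1 + n2) S" and split: "splits n1 n2 S" and s: "s \<in> carrier_vec (n1 + n2)"
  shows "s \<in> S \<longleftrightarrow> vec_first s n1 \<in> upper_part n1 n2 S \<and> vec_last s n2 \<in> lower_part n1 n2 S"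
proof
  assume "s \<in> S"
  then show "vec_first s n1 \<in> upper_part n1 n2 S \<and> vec_last s n2 \<in> lower_part n1 n2 S"
    using split unfolding splits_def upper_part_def lower_part_def by simp
next
  assume "vec_first s n1 \<in> upper_part n1 n2 S \<and> vec_last s n2 \<in> lower_part n1 n2 S"
  then have "(vec_first s n1 @\<^sub>v 0\<^sub>v n2) + (0\<^sub>v n1 @\<^sub>v vec_last s n2) \<in> S"
    using S unfolding upper_part_def lower_part_def csubspace_def by simp
  also have "(vec_first s n1 @\<^sub>v 0\<^sub>v n2) + (0\<^sub>v n1 @\<^sub>v vec_last s n2) = s"
    using vec_first_last_append[OF s]
    by (simp add: append_vec_add[OF vec_first_carrier zero_carrier_vec zero_carrier_vec vec_last_carrier])
  finally show "s \<in> S" .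
qed

lemma splits_eq_carrier:
  assumes S: "csubspace (n1 + n2) S" and split: "splits n1 n2 S"
    and "upper_part n1 n2 S = carrier_vec n1" and "lower_part n1 n2 S = carrier_vec n2"
  shows "S = carrier_vec (n1 + n2)"
  using assms splits_mem_iff[OF S split] by (auto simp: csubspace_def)

lemma splits_eq_zero:
  assumes S: "csubspace (n1 + n2) S" and split: "splits n1 n2 S"
    and "upper_part n1 n2 S = {0\<^sub>v n1}" and "lower_part n1 n2 S = {0\<^sub>v n2}"
  shows "S = {0\<^sub>v (n1 + n2)}"
proof -
  have "s = 0\<^sub>v (n1 + n2)" if "s \<in> S" for s
  proof -
    have s: "s \<in> carrier_vec (n1 + n2)" using S that by (auto simp: csubspace_def)
    with that assms(3,4) have "vec_first s n1 = 0\<^sub>v n1" "vec_last s n2 = 0\<^sub>v n2"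
      using splits_mem_iff[OF S split] by auto
    then have "s = 0\<^sub>v n1 @\<^sub>v 0\<^sub>v n2" using vec_first_last_append[OF s] by simp
    also have "\<dots> = 0\<^sub>v (n1 + n2)" by (rule eq_vecI) auto
    finally show ?thesis .
  qed
  with S show ?thesis by (auto simp: csubspace_def)
qed

lemma invariant2_upper_part:
  assumes "A1 \<in> carrier_mat n1 n1" "D1 \<in> carrier_mat n2 n2"
    and "A2 \<in> carrier_mat n1 n1" "D2 \<in> carrier_mat n2 n2"
    and split: "splits n1 n2 S"
    and inv: "invariant2 (four_block_mat A1 B1 C1 D1) (four_block_mat A2 B2 C2 D2) S"
  shows "invariant2 A1 A2 (upper_part n1 n2 S)"
  unfolding invariant2_def
proof
  fix a assume "a \<in> upper_part n1 n2 S"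
  then have a: "a \<in> carrier_vec n1" "a @\<^sub>v 0\<^sub>v n2 \<in> S" by (simp_all add: upper_part_def)
  then have "four_block_mat A1 B1 C1 D1 *\<^sub>v (a @\<^sub>v 0\<^sub>v n2) \<in> S"
    "four_block_mat A2 B2 C2 D2 *\<^sub>v (a @\<^sub>v 0\<^sub>v n2) \<in> S"
    using inv by (auto simp: invariant2_def)
  then show "A1 *\<^sub>v a \<in> upper_part n1 n2 S \<and> A2 *\<^sub>v a \<in> upper_part n1 n2 S"
    using split a assms(1-4) by (auto simp: splits_def upper_part_def vec_first_four_block_mat_mult)
qed

lemma invariant2_lower_part:
  assumes "A1 \<in> carrier_mat n1 n1" "D1 \<in> carrier_mat n2 n2"
    and "A2 \<in> carrier_mat n1 n1" "D2 \<in> carrier_mat n2 n2"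
    and split: "splits n1 n2 S"
    and inv: "invariant2 (four_block_mat A1 B1 C1 D1) (four_block_mat A2 B2 C2 D2) S"
  shows "invariant2 D1 D2 (lower_part n1 n2 S)"
  unfolding invariant2_def
proof
  fix d assume "d \<in> lower_part n1 n2 S"
  then have d: "d \<in> carrier_vec n2" "0\<^sub>v n1 @\<^sub>v d \<in> S" by (simp_all add: lower_part_def)
  then have "four_block_mat A1 B1 C1 D1 *\<^sub>v (0\<^sub>v n1 @\<^sub>v d) \<in> S"
    "four_block_mat A2 B2 C2 D2 *\<^sub>v (0\<^sub>v n1 @\<^sub>v d) \<in> S"
    using inv by (auto simp: invariant2_def)
  then show "D1 *\<^sub>v d \<in> lower_part n1 n2 S \<and> D2 *\<^sub>v d \<in> lower_part n1 n2 S"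
    using split d assms(1-4) by (auto simp: splits_def lower_part_def vec_last_four_block_mat_mult)
qed

lemma vstack_image_in_parts:
  assumes I1: "I1 \<in> carrier_mat n1 c" and I2: "I2 \<in> carrier_mat n2 c" and u: "u \<in> carrier_vec c"
    and split: "splits n1 n2 S" and mem: "vstack I1 I2 *\<^sub>v u \<in> S"
  shows "I1 *\<^sub>v u \<in> upper_part n1 n2 S" and "I2 *\<^sub>v u \<in> lower_part n1 n2 S"
  using split mem I1 I2 u
  unfolding vstack_mult_vec[OF I1 I2 u] splits_def upper_part_def lower_part_def by force+

lemma parts_in_kernel:
  assumes J1: "J1 \<in> carrier_mat r n1" and J2: "J2 \<in> carrier_mat r n2"
    and ker: "S \<subseteq> {v. hstack J1 J2 *\<^sub>v v = 0\<^sub>v r}"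
  shows "upper_part n1 n2 S \<subseteq> {v. J1 *\<^sub>v v = 0\<^sub>v r}"
    and "lower_part n1 n2 S \<subseteq> {v. J2 *\<^sub>v v = 0\<^sub>v r}"
  using ker J1 J2 by (auto simp: upper_part_def lower_part_def hstack_mult_vec)

lemma block_diag_invariant_splits:
  fixes A D :: "complex mat"
  assumes A: "A \<in> carrier_mat n1 n1" and D: "D \<in> carrier_mat n2 n2"
    and no_common: "\<And>c. eigenvalue A c \<Longrightarrow> \<not> eigenvalue D c"
    and S: "csubspace (n1 + n2) S"
    and inv: "\<forall>u\<in>S. four_block_mat A (0\<^sub>m n1 n2) (0\<^sub>m n2 n1) D *\<^sub>v u \<in> S"
  shows "splits n1 n2 S"
  unfolding splits_def
proof
  fix s assume s: "s \<in> S"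
  let ?M = "four_block_mat A (0\<^sub>m n1 n2) (0\<^sub>m n2 n1) D"
  define a where "a = vec_first s n1"
  define d where "d = vec_last s n2"
  have a: "a \<in> carrier_vec n1" and d: "d \<in> carrier_vec n2" unfolding a_def d_def by simp_all
  have ad: "a @\<^sub>v d = s"
    using S s vec_first_last_append unfolding a_def d_def csubspace_def by blast
  have M: "?M \<in> carrier_mat (n1 + n2) (n1 + n2)" using A D by simp
  obtain p where p: "p \<noteq> 0" "poly_mat_vec A p a = 0\<^sub>v n1"
    and p_roots: "\<And>\<mu>. poly p \<mu> = 0 \<Longrightarrow> eigenvalue A \<mu>"
    using minimal_annihilator_roots_are_eigenvalues[OF A a] by blast
  obtain q where q: "poly_mat_vec D q d = 0\<^sub>v n2"
    and q_roots: "\<And>\<mu>. poly q \<mu> = 0 \<Longrightarrow> eigenvalue D \<mu>"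
    using minimal_annihilator_roots_are_eigenvalues[OF D d] by blast
  have "coprime p q"
    using p(1) p_roots q_roots no_common by (blast intro: coprime_if_no_common_root)
  then obtain u v where uv: "u * p + v * q = 1"
    using bezout_coefficients_fst_snd[of p q] by (auto simp: coprime_iff_gcd_eq_1)
  \<comment> \<open>By Bezout, \<open>(v q)(A)\<close> and \<open>(u p)(A)\<close> act on the two blocks as the projections.\<close>
  have proj: "poly_mat_vec A (v * q) a = a" "poly_mat_vec D (v * q) d = 0\<^sub>v n2"
    "poly_mat_vec A (u * p) a = 0\<^sub>v n1" "poly_mat_vec D (u * p) d = d"
    using poly_mat_vec_add[OF A a, of "u * p" "v * q"] poly_mat_vec_add[OF D d, of "u * p" "v * q"]
      A D a d p(2) q uv
    by (simp_all add: poly_mat_vec_mult poly_mat_vec_zero_vec poly_mat_vec_1)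
  have "poly_mat_vec ?M f (a @\<^sub>v d) \<in> S" for f
    using poly_mat_vec_mem_invariant[OF M S inv s] unfolding ad .
  from this[of "v * q"] this[of "u * p"]
  show "vec_first s n1 @\<^sub>v 0\<^sub>v n2 \<in> S \<and> 0\<^sub>v n1 @\<^sub>v vec_last s n2 \<in> S"
    unfolding a_def[symmetric] d_def[symmetric] poly_mat_vec_block_diag[OF A D a d] proj by simp
qed

section \<open>Ampliations\<close>

text \<open>The locale views \<open>\<complex>\<^bsup>dim r\<^esup>\<close> as \<open>\<complex>\<^sup>r \<otimes> \<complex>\<^sup>m\<close> (in either order of the factors), with
  \<open>amp X = X \<otimes> 1\<close>; \<open>slice r b\<close> contracts with and \<open>embed r b\<close> tensors by the \<open>b\<close>-th standard
  basis vector of \<open>\<complex>\<^sup>m\<close>.\<close>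

locale ampliation =
  fixes m :: nat
    and dim :: "nat \<Rightarrow> nat"
    and amp :: "complex mat \<Rightarrow> complex mat"
    and slice :: "nat \<Rightarrow> nat \<Rightarrow> complex vec \<Rightarrow> complex vec"
    and embed :: "nat \<Rightarrow> nat \<Rightarrow> complex vec \<Rightarrow> complex vec"
  assumes amp_carrier: "X \<in> carrier_mat r c \<Longrightarrow> amp X \<in> carrier_mat (dim r) (dim c)"
    and clinear_slice: "b < m \<Longrightarrow> clinear_on (dim r) r (slice r b)"
    and embed_carrier: "u \<in> carrier_vec r \<Longrightarrow> embed r b u \<in> carrier_vec (dim r)"
    and slice_embed: "b < m \<Longrightarrow> b' < m \<Longrightarrow> u \<in> carrier_vec r \<Longrightarrow>
      slice r b' (embed r b u) = (if b' = b then u else 0\<^sub>v r)"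
    and slice_amp_mult: "X \<in> carrier_mat r c \<Longrightarrow> v \<in> carrier_vec (dim c) \<Longrightarrow> b < m \<Longrightarrow>
      slice r b (amp X *\<^sub>v v) = X *\<^sub>v slice c b v"
    and slices_inject: "v \<in> carrier_vec (dim r) \<Longrightarrow> v' \<in> carrier_vec (dim r) \<Longrightarrow>
      (\<And>b. b < m \<Longrightarrow> slice r b v = slice r b v') \<Longrightarrow> v = v'"
begin

lemma slice_carrier: "b < m \<Longrightarrow> v \<in> carrier_vec (dim r) \<Longrightarrow> slice r b v \<in> carrier_vec r"
  using clinear_slice by (simp add: clinear_on_def)

lemma slice_zero: "b < m \<Longrightarrow> slice r b (0\<^sub>v (dim r)) = 0\<^sub>v r"
  using clinear_slice by (rule clinear_on_zero)

lemma slices_zero_imp_zero: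
  assumes "v \<in> carrier_vec (dim r)" and "\<And>b. b < m \<Longrightarrow> slice r b v = 0\<^sub>v r"
  shows "v = 0\<^sub>v (dim r)"
  using assms(1) zero_carrier_vec by (rule slices_inject) (simp add: assms(2) slice_zero)

lemma clinear_embed:
  assumes b: "b < m"
  shows "clinear_on r (dim r) (embed r b)"
  unfolding clinear_on_def
proof (intro conjI ballI allI)
  fix u v :: "complex vec" and c assume u: "u \<in> carrier_vec r" and v: "v \<in> carrier_vec r"
  show "embed r b u \<in> carrier_vec (dim r)" using u by (rule embed_carrier)
  have slice_add: "slice r b' (x + y) = slice r b' x + slice r b' y"
    if "b' < m" "x \<in> carrier_vec (dim r)" "y \<in> carrier_vec (dim r)" for b' x y
    using clinear_slice[OF that(1), of r] that(2,3) by (simp add: clinear_on_def)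
  have slice_smult: "slice r b' (c \<cdot>\<^sub>v x) = c \<cdot>\<^sub>v slice r b' x"
    if "b' < m" "x \<in> carrier_vec (dim r)" for b' x
    using clinear_slice[OF that(1), of r] that(2) by (simp add: clinear_on_def)
  show "embed r b (u + v) = embed r b u + embed r b v"
  proof (rule slices_inject)
    fix b' assume "b' < m"
    then show "slice r b' (embed r b (u + v)) = slice r b' (embed r b u + embed r b v)"
      using u v b by (simp add: slice_add embed_carrier slice_embed)
  qed (use u v in \<open>simp_all add: embed_carrier\<close>)
  show "embed r b (c \<cdot>\<^sub>v u) = c \<cdot>\<^sub>v embed r b u"
  proof (rule slices_inject)
    fix b' assume "b' < m"
    then show "slice r b' (embed r b (c \<cdot>\<^sub>v u)) = slice r b' (c \<cdot>\<^sub>v embed r b u)"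
      using u b by (simp add: slice_smult embed_carrier slice_embed)
  qed (use u in \<open>simp_all add: embed_carrier\<close>)
qed

lemma amp_mult_embed:
  assumes X: "X \<in> carrier_mat r c" and u: "u \<in> carrier_vec c" and b: "b < m"
  shows "amp X *\<^sub>v embed c b u = embed r b (X *\<^sub>v u)"
proof (rule slices_inject)
  fix b' assume "b' < m"
  then show "slice r b' (amp X *\<^sub>v embed c b u) = slice r b' (embed r b (X *\<^sub>v u))"
    using X u b by (simp add: slice_amp_mult embed_carrier slice_embed)
qed (use amp_carrier[OF X] X u in \<open>simp_all add: embed_carrier\<close>)

lemma embeds_span:
  assumes S: "csubspace (dim r) S"
    and embed_mem: "\<And>b u. b < m \<Longrightarrow> u \<in> carrier_vec r \<Longrightarrow> embed r b u \<in> S"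
  shows "S = carrier_vec (dim r)"
proof
  show "S \<subseteq> carrier_vec (dim r)" using S by (simp add: csubspace_def)
  \<comment> \<open>Induction on \<open>k\<close>: subtracting \<open>embed r k (slice r k v)\<close> kills the \<open>k\<close>-th slice.\<close>
  have "\<forall>v\<in>carrier_vec (dim r). (\<forall>b. k \<le> b \<and> b < m \<longrightarrow> slice r b v = 0\<^sub>v r) \<longrightarrow> v \<in> S" for k
  proof (induct k)
    case 0
    show ?case using S slices_zero_imp_zero by (auto simp: csubspace_def)
  next
    case (Suc k)
    show ?case
    proof (intro ballI impI)
      fix v assume v: "v \<in> carrier_vec (dim r)"
        and high: "\<forall>b. Suc k \<le> b \<and> b < m \<longrightarrow> slice r b v = 0\<^sub>v r"
      show "v \<in> S"
      proof (cases "k < m")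
        case False
        with Suc v high show ?thesis by (metis Suc_leI le_neq_implies_less)
      next
        case True
        define e where "e = embed r k (slice r k v)"
        have sk: "slice r k v \<in> carrier_vec r" using True v by (rule slice_carrier)
        have e: "e \<in> carrier_vec (dim r)" "e \<in> S"
          unfolding e_def using embed_carrier[OF sk] embed_mem[OF True sk] by auto
        define v' where "v' = v + (-1) \<cdot>\<^sub>v e"
        have v': "v' \<in> carrier_vec (dim r)" unfolding v'_def using v e by simp
        have "slice r b v' = 0\<^sub>v r" if "k \<le> b" "b < m" for b
        proof -
          have "slice r b v' = slice r b v + (-1) \<cdot>\<^sub>v slice r b e"
            using clinear_slice[OF \<open>b < m\<close>, of r] v e by (simp add: v'_def clinear_on_def)
          also have "\<dots> = slice r b v + (-1) \<cdot>\<^sub>v (if b = k then slice r k v else 0\<^sub>v r)"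
            using that True sk by (simp add: e_def slice_embed)
          also have "\<dots> = 0\<^sub>v r"
            using that high sk by (cases "b = k") auto
          finally show ?thesis .
        qed
        with Suc v' have "v' \<in> S" by blast
        with e S have "v' + e \<in> S" by (simp add: csubspace_def)
        also have "v' + e = v" unfolding v'_def using v e by (intro eq_vecI) auto
        finally show ?thesis .
      qed
    qed
  qed
  from this[of m] show "carrier_vec (dim r) \<subseteq> S" by auto
qed

lemma eigenvalue_amp:
  assumes B: "B \<in> carrier_mat n n" and ev: "eigenvalue (amp B) c"
  shows "eigenvalue B c"
proof -
  obtain v where v: "v \<in> carrier_vec (dim n)" "v \<noteq> 0\<^sub>v (dim n)" "amp B *\<^sub>v v = c \<cdot>\<^sub>v v"
    using ev amp_carrier[OF B] unfolding eigenvalue_def eigenvector_def by auto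
  then obtain b where b: "b < m" "slice n b v \<noteq> 0\<^sub>v n"
    using slices_zero_imp_zero by blast
  have "B *\<^sub>v slice n b v = slice n b (c \<cdot>\<^sub>v v)"
    using slice_amp_mult[OF B v(1) b(1)] v(3) by simp
  also have "\<dots> = c \<cdot>\<^sub>v slice n b v"
    using clinear_slice[OF b(1), of n] v(1) by (simp add: clinear_on_def)
  finally show ?thesis
    unfolding eigenvalue_def eigenvector_def using B b slice_carrier[OF b(1) v(1)] by auto
qed

lemma stable_imp_amp_subspace_full:
  assumes B1: "B1 \<in> carrier_mat n n" and B2: "B2 \<in> carrier_mat n n" and i: "i \<in> carrier_mat n w"
    and stable: "stable (B1, B2, i, j)"
    and S: "csubspace (dim n) S" and im: "\<forall>u\<in>carrier_vec (dim w). amp i *\<^sub>v u \<in> S"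
    and inv: "invariant2 (amp B1) (amp B2) S"
  shows "S = carrier_vec (dim n)"
proof (rule embeds_span[OF S])
  fix b and u :: "complex vec" assume b: "b < m" and u: "u \<in> carrier_vec n"
  let ?T = "{u \<in> carrier_vec n. embed n b u \<in> S}"
  have "csubspace n ?T" using csubspace_vimage[OF clinear_embed[OF b] S] .
  moreover have "\<forall>x\<in>carrier_vec w. i *\<^sub>v x \<in> ?T"
    using i im b by (auto simp: amp_mult_embed[symmetric] embed_carrier)
  moreover have "invariant2 B1 B2 ?T"
    using inv B1 B2 b by (auto simp: invariant2_def amp_mult_embed[symmetric] embed_carrier)
  ultimately have "?T = carrier_vec n"
    using stable B1 i unfolding stable_def by auto
  with u show "embed n b u \<in> S" by blast
qed

lemma costable_imp_amp_subspace_zero: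
  assumes B1: "B1 \<in> carrier_mat n n" and B2: "B2 \<in> carrier_mat n n" and j: "j \<in> carrier_mat w n"
    and costable: "costable (B1, B2, i, j)"
    and S: "csubspace (dim n) S" and ker: "S \<subseteq> {v. amp j *\<^sub>v v = 0\<^sub>v (dim w)}"
    and inv: "invariant2 (amp B1) (amp B2) S"
  shows "S = {0\<^sub>v (dim n)}"
proof
  show "{0\<^sub>v (dim n)} \<subseteq> S" using S by (simp add: csubspace_def)
  have Sc: "S \<subseteq> carrier_vec (dim n)" using S by (simp add: csubspace_def)
  have "slice n b s = 0\<^sub>v n" if b: "b < m" and s: "s \<in> S" for b s
  proof -
    let ?T = "slice n b ` S"
    have "csubspace n ?T" using csubspace_image[OF clinear_slice[OF b] S] .
    moreover have "j *\<^sub>v slice n b x = 0\<^sub>v w" if "x \<in> S" for x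
    proof -
      have "j *\<^sub>v slice n b x = slice w b (amp j *\<^sub>v x)"
        using slice_amp_mult[OF j _ b] Sc that by auto
      also have "\<dots> = 0\<^sub>v w" using ker that b by (auto simp: slice_zero)
      finally show ?thesis .
    qed
    then have "?T \<subseteq> {v. j *\<^sub>v v = 0\<^sub>v (dim_row j)}" using j by auto
    moreover have "invariant2 B1 B2 ?T"
      using inv Sc B1 B2 b
      by (auto simp: invariant2_def slice_amp_mult[symmetric] intro!: imageI)
    ultimately have "?T = {0\<^sub>v n}"
      using costable B1 unfolding costable_def by auto
    with s show ?thesis by blast
  qed
  then show "S \<subseteq> {0\<^sub>v (dim n)}" using Sc slices_zero_imp_zero by blast
qed

end

section \<open>Kronecker products with an identity matrix\<close>

lemma mult_add_less_mult:
  fixes q r b m :: nat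
  assumes "q < r" "b < m"
  shows "q * m + b < r * m"
proof -
  have "q * m + b < Suc q * m" using assms(2) by simp
  also have "\<dots> \<le> r * m" using assms(1) by (intro mult_right_mono) auto
  finally show ?thesis .
qed

lemma sum_lessThan_mult:
  fixes f :: "nat \<Rightarrow> 'a :: comm_monoid_add"
  shows "(\<Sum>p<c * m. f p) = (\<Sum>a<c. \<Sum>e<m. f (a * m + e))"
proof -
  have "sum f {a * m..<a * m + m} = (\<Sum>e<m. f (a * m + e))" for a
    using sum.shift_bounds_nat_ivl[of f 0 "a * m" m] by (simp add: add.commute lessThan_atLeast0)
  then show ?thesis using sum.nat_group[of f m c] by simp
qed

lemma kron_carrier [simp]:
  "X \<in> carrier_mat r1 c1 \<Longrightarrow> Y \<in> carrier_mat r2 c2 \<Longrightarrow> kron X Y \<in> carrier_mat (r1 * r2) (c1 * c2)"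
  unfolding kron_def by simp

lemma kron_mult_vec_index:
  assumes X: "X \<in> carrier_mat r1 c1" and Y: "Y \<in> carrier_mat r2 c2" and v: "v \<in> carrier_vec (c1 * c2)"
    and q: "q < r1" and d: "d < r2"
  shows "(kron X Y *\<^sub>v v) $ (q * r2 + d)
       = (\<Sum>a<c1. \<Sum>e<c2. X $$ (q, a) * Y $$ (d, e) * v $ (a * c2 + e))"
proof -
  have qd: "q * r2 + d < r1 * r2" using q d by (rule mult_add_less_mult)
  have "(kron X Y *\<^sub>v v) $ (q * r2 + d) = (\<Sum>p<c1 * c2. kron X Y $$ (q * r2 + d, p) * v $ p)"
    using X Y v qd by (intro mat_vec_index_sum) auto
  also have "\<dots> = (\<Sum>a<c1. \<Sum>e<c2. kron X Y $$ (q * r2 + d, a * c2 + e) * v $ (a * c2 + e))"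
    by (rule sum_lessThan_mult)
  also have "\<dots> = (\<Sum>a<c1. \<Sum>e<c2. X $$ (q, a) * Y $$ (d, e) * v $ (a * c2 + e))"
    using X Y qd d mult_add_less_mult[of _ c1 _ c2] by (intro sum.cong refl) (auto simp: kron_def)
  finally show ?thesis .
qed

definition right_slice :: "nat \<Rightarrow> nat \<Rightarrow> nat \<Rightarrow> complex vec \<Rightarrow> complex vec" where
  "right_slice m r b v = vec r (\<lambda>q. v $ (q * m + b))"

definition right_embed :: "nat \<Rightarrow> nat \<Rightarrow> nat \<Rightarrow> complex vec \<Rightarrow> complex vec" where
  "right_embed m r b u = vec (r * m) (\<lambda>p. if p mod m = b then u $ (p div m) else 0)"

lemma right_slice_kron_mult:
  assumes X: "X \<in> carrier_mat r c" and v: "v \<in> carrier_vec (c * m)" and b: "b < m"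
  shows "right_slice m r b (kron X (1\<^sub>m m) *\<^sub>v v) = X *\<^sub>v right_slice m c b v"
proof (rule eq_vecI)
  fix q assume "q < dim_vec (X *\<^sub>v right_slice m c b v)"
  then have q: "q < r" using X by simp
  have "(kron X (1\<^sub>m m) *\<^sub>v v) $ (q * m + b)
      = (\<Sum>a<c. \<Sum>e<m. X $$ (q, a) * 1\<^sub>m m $$ (b, e) * v $ (a * m + e))"
    using X v q b by (intro kron_mult_vec_index) auto
  also have "\<dots> = (\<Sum>a<c. \<Sum>e<m. if e = b then X $$ (q, a) * v $ (a * m + b) else 0)"
    using b by (intro sum.cong refl) auto
  also have "\<dots> = (\<Sum>a<c. X $$ (q, a) * v $ (a * m + b))"
    using b by simp
  also have "\<dots> = (X *\<^sub>v right_slice m c b v) $ q"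
    using X q by (subst mat_vec_index_sum[OF X _ q]) (auto simp: right_slice_def)
  finally show "right_slice m r b (kron X (1\<^sub>m m) *\<^sub>v v) $ q = (X *\<^sub>v right_slice m c b v) $ q"
    using q by (simp add: right_slice_def)
qed (use X in \<open>simp add: right_slice_def\<close>)

interpretation kron_right:
  ampliation m "\<lambda>r. r * m" "\<lambda>X. kron X (1\<^sub>m m)" "right_slice m" "right_embed m" for m
proof
  show "kron X (1\<^sub>m m) \<in> carrier_mat (r * m) (c * m)" if "X \<in> carrier_mat r c" for X r c
    using that by simp
  show "clinear_on (r * m) r (right_slice m r b)" if "b < m" for r b
    unfolding clinear_on_def right_slice_def
    using that mult_add_less_mult[of _ r b m] by auto
  show "right_embed m r b u \<in> carrier_vec (r * m)" for r b u
    by (simp add: right_embed_def)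
  show "right_slice m r b' (right_embed m r b u) = (if b' = b then u else 0\<^sub>v r)"
    if "b < m" "b' < m" "u \<in> carrier_vec r" for r b b' u
    using that mult_add_less_mult[of _ r b' m] by (auto simp: right_slice_def right_embed_def)
  show "right_slice m r b (kron X (1\<^sub>m m) *\<^sub>v v) = X *\<^sub>v right_slice m c b v"
    if "X \<in> carrier_mat r c" "v \<in> carrier_vec (c * m)" "b < m" for X r c v b
    using that by (rule right_slice_kron_mult)
  fix r v v' assume v: "v \<in> carrier_vec (r * m)" "v' \<in> carrier_vec (r * m)"
    and slices: "\<And>b. b < m \<Longrightarrow> right_slice m r b v = right_slice m r b v'"
  show "v = v'"
  proof (rule eq_vecI)
    fix p assume "p < dim_vec v'"
    with v have p: "p < r * m" by simp
    then have "m > 0" by (cases m) auto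
    with p have "p div m < r" "p mod m < m" by (auto simp: less_mult_imp_div_less)
    with slices[of "p mod m"] have "v $ (p div m * m + p mod m) = v' $ (p div m * m + p mod m)"
      by (auto simp: right_slice_def dest: arg_cong[where f = "\<lambda>x. x $ (p div m)"])
    then show "v $ p = v' $ p" by simp
  qed (use v in simp)
qed

definition left_slice :: "nat \<Rightarrow> nat \<Rightarrow> nat \<Rightarrow> complex vec \<Rightarrow> complex vec" where
  "left_slice m r k v = vec r (\<lambda>d. v $ (k * r + d))"

definition left_embed :: "nat \<Rightarrow> nat \<Rightarrow> nat \<Rightarrow> complex vec \<Rightarrow> complex vec" where
  "left_embed m r k u = vec (m * r) (\<lambda>p. if p div r = k then u $ (p mod r) else 0)"

lemma left_slice_kron_mult:
  assumes Y: "Y \<in> carrier_mat r c" and v: "v \<in> carrier_vec (m * c)" and k: "k < m"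
  shows "left_slice m r k (kron (1\<^sub>m m) Y *\<^sub>v v) = Y *\<^sub>v left_slice m c k v"
proof (rule eq_vecI)
  fix d assume "d < dim_vec (Y *\<^sub>v left_slice m c k v)"
  then have d: "d < r" using Y by simp
  have "(kron (1\<^sub>m m) Y *\<^sub>v v) $ (k * r + d)
      = (\<Sum>a<m. \<Sum>e<c. 1\<^sub>m m $$ (k, a) * Y $$ (d, e) * v $ (a * c + e))"
    using Y v d k by (intro kron_mult_vec_index) auto
  also have "\<dots> = (\<Sum>a<m. if a = k then \<Sum>e<c. Y $$ (d, e) * v $ (k * c + e) else 0)"
    using k by (intro sum.cong refl) auto
  also have "\<dots> = (\<Sum>e<c. Y $$ (d, e) * v $ (k * c + e))"
    using k by simp
  also have "\<dots> = (Y *\<^sub>v left_slice m c k v) $ d"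
    using Y d by (subst mat_vec_index_sum[OF Y _ d]) (auto simp: left_slice_def)
  finally show "left_slice m r k (kron (1\<^sub>m m) Y *\<^sub>v v) $ d = (Y *\<^sub>v left_slice m c k v) $ d"
    using d by (simp add: left_slice_def)
qed (use Y in \<open>simp add: left_slice_def\<close>)

interpretation kron_left:
  ampliation m "\<lambda>r. m * r" "kron (1\<^sub>m m)" "left_slice m" "left_embed m" for m
proof
  show "kron (1\<^sub>m m) X \<in> carrier_mat (m * r) (m * c)" if "X \<in> carrier_mat r c" for X r c
    using that by simp
  show "clinear_on (m * r) r (left_slice m r k)" if "k < m" for r k
    unfolding clinear_on_def left_slice_def
    using that mult_add_less_mult[of k m _ r] by auto
  show "left_embed m r k u \<in> carrier_vec (m * r)" for r k u
    by (simp add: left_embed_def)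
  show "left_slice m r k' (left_embed m r k u) = (if k' = k then u else 0\<^sub>v r)"
    if "k < m" "k' < m" "u \<in> carrier_vec r" for r k k' u
    using that mult_add_less_mult[of k' m _ r] by (auto simp: left_slice_def left_embed_def)
  show "left_slice m r k (kron (1\<^sub>m m) Y *\<^sub>v v) = Y *\<^sub>v left_slice m c k v"
    if "Y \<in> carrier_mat r c" "v \<in> carrier_vec (m * c)" "k < m" for Y r c v k
    using that by (rule left_slice_kron_mult)
  fix r v v' assume v: "v \<in> carrier_vec (m * r)" "v' \<in> carrier_vec (m * r)"
    and slices: "\<And>k. k < m \<Longrightarrow> left_slice m r k v = left_slice m r k v'"
  show "v = v'"
  proof (rule eq_vecI)
    fix p assume "p < dim_vec v'"
    with v have p: "p < m * r" by simp
    then have "r > 0" by (cases r) auto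
    with p have "p div r < m" "p mod r < r" by (auto simp: less_mult_imp_div_less mult.commute)
    with slices[of "p div r"] have "v $ (p div r * r + p mod r) = v' $ (p div r * r + p mod r)"
      by (auto simp: left_slice_def dest: arg_cong[where f = "\<lambda>x. x $ (p mod r)"])
    then show "v $ p = v' $ p" by simp
  qed (use v in simp)
qed

section \<open>The tensor product datum\<close>

lemma kron_block_diag_invariant_splits:
  fixes B1 B1' M :: "complex mat"
  assumes B1: "B1 \<in> carrier_mat n n" and B1': "B1' \<in> carrier_mat n' n'"
    and no_common: "\<And>c. eigenvalue B1 c \<Longrightarrow> \<not> eigenvalue B1' c"
    and S: "csubspace (n * w' + w * n') S"
    and inv: "invariant2 (four_block_mat (kron B1 (1\<^sub>m w')) (0\<^sub>m (n * w') (w * n'))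
      (0\<^sub>m (w * n') (n * w')) (kron (1\<^sub>m w) B1')) M S"
  shows "splits (n * w') (w * n') S"
proof (rule block_diag_invariant_splits[OF _ _ _ S])
  show "kron B1 (1\<^sub>m w') \<in> carrier_mat (n * w') (n * w')"
    and "kron (1\<^sub>m w) B1' \<in> carrier_mat (w * n') (w * n')" using B1 B1' by simp_all
  show "\<not> eigenvalue (kron (1\<^sub>m w) B1') c" if "eigenvalue (kron B1 (1\<^sub>m w')) c" for c
    using that no_common B1 B1' kron_right.eigenvalue_amp kron_left.eigenvalue_amp by blast
qed (use inv in \<open>simp add: invariant2_def\<close>)

lemma stable_block_tensor:
  fixes B1 B2 i B1' B2' i' X Y J :: "complex mat" and n w n' w' :: nat
  assumes B1: "B1 \<in> carrier_mat n n" and B2: "B2 \<in> carrier_mat n n" and i: "i \<in> carrier_mat n w"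
    and B1': "B1' \<in> carrier_mat n' n'" and B2': "B2' \<in> carrier_mat n' n'" and i': "i' \<in> carrier_mat n' w'"
    and no_common: "\<And>c. eigenvalue B1 c \<Longrightarrow> \<not> eigenvalue B1' c"
    and stable: "stable (B1, B2, i, j)" and stable': "stable (B1', B2', i', j')"
  shows "stable (four_block_mat (kron B1 (1\<^sub>m w')) (0\<^sub>m (n * w') (w * n')) (0\<^sub>m (w * n') (n * w'))
                   (kron (1\<^sub>m w) B1'),
                 four_block_mat (kron B2 (1\<^sub>m w')) X Y (kron (1\<^sub>m w) B2'),
                 vstack (kron i (1\<^sub>m w')) (kron (1\<^sub>m w) i'), J)"
proof -
  let ?N1 = "n * w'" and ?N2 = "w * n'"
  let ?I1 = "kron i (1\<^sub>m w')" and ?I2 = "kron (1\<^sub>m w) i'"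
  have I: "?I1 \<in> carrier_mat ?N1 (w * w')" "?I2 \<in> carrier_mat ?N2 (w * w')" using i i' by auto
  have carriers: "kron B1 (1\<^sub>m w') \<in> carrier_mat ?N1 ?N1" "kron (1\<^sub>m w) B1' \<in> carrier_mat ?N2 ?N2"
    "kron B2 (1\<^sub>m w') \<in> carrier_mat ?N1 ?N1" "kron (1\<^sub>m w) B2' \<in> carrier_mat ?N2 ?N2"
    using B1 B2 B1' B2' by auto
  have dims: "dim_row (four_block_mat (kron B1 (1\<^sub>m w')) (0\<^sub>m ?N1 ?N2) (0\<^sub>m ?N2 ?N1) (kron (1\<^sub>m w) B1'))
      = ?N1 + ?N2" "dim_col (vstack ?I1 ?I2) = w * w'"
    using carriers I by (simp_all add: vstack_def)
  show ?thesis
    unfolding stable_def prod.case dims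
  proof (intro allI impI, elim conjE)
    fix S assume S: "csubspace (?N1 + ?N2) S" and im: "\<forall>u\<in>carrier_vec (w * w'). vstack ?I1 ?I2 *\<^sub>v u \<in> S"
      and inv: "invariant2 (four_block_mat (kron B1 (1\<^sub>m w')) (0\<^sub>m ?N1 ?N2) (0\<^sub>m ?N2 ?N1) (kron (1\<^sub>m w) B1'))
        (four_block_mat (kron B2 (1\<^sub>m w')) X Y (kron (1\<^sub>m w) B2')) S"
    have split: "splits ?N1 ?N2 S"
      using B1 B1' no_common S inv by (rule kron_block_diag_invariant_splits)
    have "upper_part ?N1 ?N2 S = carrier_vec ?N1"
      using B1 B2 i stable csubspace_upper_part[OF S] _ invariant2_upper_part[OF carriers split inv]
      by (rule kron_right.stable_imp_amp_subspace_full) (use I split im vstack_image_in_parts(1) in blast)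
    moreover have "lower_part ?N1 ?N2 S = carrier_vec ?N2"
      using B1' B2' i' stable' csubspace_lower_part[OF S] _ invariant2_lower_part[OF carriers split inv]
      by (rule kron_left.stable_imp_amp_subspace_full) (use I split im vstack_image_in_parts(2) in blast)
    ultimately show "S = carrier_vec (?N1 + ?N2)" by (rule splits_eq_carrier[OF S split])
  qed
qed

lemma costable_block_tensor:
  fixes B1 B2 j B1' B2' j' X Y I :: "complex mat" and n w n' w' :: nat
  assumes B1: "B1 \<in> carrier_mat n n" and B2: "B2 \<in> carrier_mat n n" and j: "j \<in> carrier_mat w n"
    and B1': "B1' \<in> carrier_mat n' n'" and B2': "B2' \<in> carrier_mat n' n'" and j': "j' \<in> carrier_mat w' n'"
    and no_common: "\<And>c. eigenvalue B1 c \<Longrightarrow> \<not> eigenvalue B1' c"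
    and costable: "costable (B1, B2, i, j)" and costable': "costable (B1', B2', i', j')"
  shows "costable (four_block_mat (kron B1 (1\<^sub>m w')) (0\<^sub>m (n * w') (w * n')) (0\<^sub>m (w * n') (n * w'))
                     (kron (1\<^sub>m w) B1'),
                   four_block_mat (kron B2 (1\<^sub>m w')) X Y (kron (1\<^sub>m w) B2'),
                   I, hstack (kron j (1\<^sub>m w')) (kron (1\<^sub>m w) j'))"
proof -
  let ?N1 = "n * w'" and ?N2 = "w * n'"
  let ?J1 = "kron j (1\<^sub>m w')" and ?J2 = "kron (1\<^sub>m w) j'"
  have J: "?J1 \<in> carrier_mat (w * w') ?N1" "?J2 \<in> carrier_mat (w * w') ?N2" using j j' by auto
  have carriers: "kron B1 (1\<^sub>m w') \<in> carrier_mat ?N1 ?N1" "kron (1\<^sub>m w) B1' \<in> carrier_mat ?N2 ?N2"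
    "kron B2 (1\<^sub>m w') \<in> carrier_mat ?N1 ?N1" "kron (1\<^sub>m w) B2' \<in> carrier_mat ?N2 ?N2"
    using B1 B2 B1' B2' by auto
  have dims: "dim_row (four_block_mat (kron B1 (1\<^sub>m w')) (0\<^sub>m ?N1 ?N2) (0\<^sub>m ?N2 ?N1) (kron (1\<^sub>m w) B1'))
      = ?N1 + ?N2" "dim_row (hstack ?J1 ?J2) = w * w'"
    using carriers J by (simp_all add: hstack_def)
  show ?thesis
    unfolding costable_def prod.case dims
  proof (intro allI impI, elim conjE)
    fix S assume S: "csubspace (?N1 + ?N2) S" and ker: "S \<subseteq> {v. hstack ?J1 ?J2 *\<^sub>v v = 0\<^sub>v (w * w')}"
      and inv: "invariant2 (four_block_mat (kron B1 (1\<^sub>m w')) (0\<^sub>m ?N1 ?N2) (0\<^sub>m ?N2 ?N1) (kron (1\<^sub>m w) B1'))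
        (four_block_mat (kron B2 (1\<^sub>m w')) X Y (kron (1\<^sub>m w) B2')) S"
    have split: "splits ?N1 ?N2 S"
      using B1 B1' no_common S inv by (rule kron_block_diag_invariant_splits)
    have "upper_part ?N1 ?N2 S = {0\<^sub>v ?N1}"
      using B1 B2 j costable csubspace_upper_part[OF S] parts_in_kernel(1)[OF J ker]
        invariant2_upper_part[OF carriers split inv]
      by (rule kron_right.costable_imp_amp_subspace_zero)
    moreover have "lower_part ?N1 ?N2 S = {0\<^sub>v ?N2}"
      using B1' B2' j' costable' csubspace_lower_part[OF S] parts_in_kernel(2)[OF J ker]
        invariant2_lower_part[OF carriers split inv]
      by (rule kron_left.costable_imp_amp_subspace_zero)
    ultimately show "S = {0\<^sub>v (?N1 + ?N2)}" by (rule splits_eq_zero[OF S split])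
  qed
qed

theorem lemma4p5:
  fixes B1 B2 i j B1' B2' i' j' :: "complex mat" and n w n' w' :: nat
  assumes "B1 \<in> carrier_mat n n" and "B2 \<in> carrier_mat n n"
    and "i \<in> carrier_mat n w" and "j \<in> carrier_mat w n"
    and "B1' \<in> carrier_mat n' n'" and "B2' \<in> carrier_mat n' n'"
    and "i' \<in> carrier_mat n' w'" and "j' \<in> carrier_mat w' n'"
    and "\<forall>c. \<not> (eigenvalue B1 c \<and> eigenvalue B1' c)"
  shows "(stable (B1, B2, i, j) \<and> stable (B1', B2', i', j')
            \<longrightarrow> stable (Tmap (B1, B2, i, j) (B1', B2', i', j')))
       \<and> (costable (B1, B2, i, j) \<and> costable (B1', B2', i', j')
            \<longrightarrow> costable (Tmap (B1, B2, i, j) (B1', B2', i', j')))"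
proof -
  have "dim_row B1 = n" "dim_col i = w" "dim_row B1' = n'" "dim_col i' = w'"
    using assms(1,3,5,7) by auto
  then have Tmap: "Tmap (B1, B2, i, j) (B1', B2', i', j') =
     (four_block_mat (kron B1 (1\<^sub>m w')) (0\<^sub>m (n * w') (w * n')) (0\<^sub>m (w * n') (n * w'))
        (kron (1\<^sub>m w) B1'),
      four_block_mat (kron B2 (1\<^sub>m w')) (Bt12 (B1, B2, i, j) (B1', B2', i', j'))
        (Bt21 (B1, B2, i, j) (B1', B2', i', j')) (kron (1\<^sub>m w) B2'),
      vstack (kron i (1\<^sub>m w')) (kron (1\<^sub>m w) i'),
      hstack (kron j (1\<^sub>m w')) (kron (1\<^sub>m w) j'))"
    unfolding Tmap_def Let_def by simp
  have no_common: "\<And>c. eigenvalue B1 c \<Longrightarrow> \<not> eigenvalue B1' c" using assms(9) by blast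
  show ?thesis
    unfolding Tmap
    using stable_block_tensor[OF assms(1-3,5-7) no_common] costable_block_tensor[OF assms(1,2,4,5,6,8) no_common]
    by blast
qed

end
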